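(* Let $\kappa(\beta\mathbb{N})$ be the smallest two-sided ideal of the semigroup $(\beta\mathbb{N},+)$. Then $\kappa(\beta\mathbb{N})$ is a null set for every counting measure, i.e. $\mu(\kappa(\beta\mathbb{N}))=0$ for every counting measure $\mu$ on $\beta\mathbb{N}$.
   Context: $\mathbb{N}=\{0,1,2,\dots\}$, $\mathbb{N}^+=\{1,2,\dots\}$, and $[a,b]$ denotes an interval of natural numbers. For a discrete set $X$, $\beta X$ is the set of ultrafilters on $X$; $\beta\mathbb{N}$ carries the compact Hausdorff topology whose basic open sets are $\overline{A}=\{p\in\beta\mathbb{N}: A\in p\}$ for $A\subseteq\mathbb{N}$ (these are clopen), and $\mathbb{N}\subseteq\beta\mathbb{N}$ via principal ultrafilters. Likewise $\overline{I}=\{q: I\in q\}$ for $I\subseteq X$. For an ultrafilter $q$ on $X$ and $f:X\to Y$ with $Y$ compact Hausdorff, $\lim_{x\to q}f(x)$ is the unique $y\in Y$ such that $f^{-1}(U)\in q$ for every open neighborhood $U$ of $y$. Addition on $\beta\mathbb{N}$: $q+p=\lim_{m\to q}\lim_{n\to p}(m+n)\in\beta\mathbb{N}$; equivalently $A\in q+p$ iff $\{n\in\mathbb{N}: A-n\in p\}\in q$, where $A-n=\{k\in\mathbb{N}:k+n\in A\}$. This operation is associative. A (nonempty) subset $I\subseteq\beta\mathbb{N}$ is a two-sided ideal if $p+I\subseteq I$ and $I+p\subseteq I$ for all $p\in\beta\mathbb{N}$. There is exactly one minimal two-sided ideal, denoted $\kappa(\beta\mathbb{N})$; it is contained in every two-sided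 ideal. Counting measure: a measure $\mu$ on $\beta\mathbb{N}$ is called a counting measure if it is a Radon measure and there is an ultrafilter $q\in\beta(\mathbb{N}^+\times\mathbb{N})$ such that $$\mu(\overline{A})=\lim_{(N,M)\to q}\frac{|A\cap[M+1,M+N]|}{N}\quad\text{for all }A\subseteq\mathbb{N},$$ where $q$ satisfies: (1) $\lim_{(N,M)\to q}\frac1N=0$; and (2) either the interval starting points are bounded, i.e. $\lim_{(N,M)\to q}M=M_0<\infty$ for some $M_0\in\mathbb{N}$ (equivalently $\{(N,M_0):N\in\mathbb{N}^+\}\in q$), or there is a set $I=\{(N_1,M_1),(N_2,M_2),\dots\}$ of disjoint and growing intervals, meaning $M_i+N_i<M_{i+1}$ and $N_i<N_{i+1}$ for all $i\ge 1$, such that $q\in\overline{I}$. As usual, a null set is a set contained in a measurable set of measure $0$. *)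

theory Defs
  imports "HOL-Analysis.Analysis"
begin

section \<open>Ultrafilters\<close>

text \<open>A set \<open>A\<close> belongs to an ultrafilter \<open>F\<close> iff \<open>eventually (\<lambda>x. x \<in> A) F\<close>.\<close>

definition is_ultrafilter :: "'a filter \<Rightarrow> bool" where
  "is_ultrafilter F \<longleftrightarrow>
     F \<noteq> bot \<and> (\<forall>P. eventually P F \<or> eventually (\<lambda>x. \<not> P x) F)"

lemma is_ultrafilter_principal: "is_ultrafilter (principal {x})"
  by (auto simp: is_ultrafilter_def eventually_principal principal_eq_bot_iff)

typedef 'a ultrafilter = "{F :: 'a filter. is_ultrafilter F}"
  morphisms filter_of Abs_ultrafilter
  using is_ultrafilter_principal[of undefined] by blast

definition principal_ultrafilter :: "'a \<Rightarrow> 'a ultrafilter" where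
  "principal_ultrafilter x = Abs_ultrafilter (principal {x})"

definition stone_set :: "'a set \<Rightarrow> 'a ultrafilter set" where
  "stone_set A = {p. eventually (\<lambda>x. x \<in> A) (filter_of p)}"

lemma filter_of_ultra: "is_ultrafilter (filter_of p)"
  using filter_of by auto

lemma filter_of_not_bot [simp]: "filter_of p \<noteq> bot"
  using filter_of_ultra by (auto simp: is_ultrafilter_def)

lemma ultra_not: 
  assumes "is_ultrafilter F"
  shows "eventually (\<lambda>x. \<not> P x) F \<longleftrightarrow> \<not> eventually P F"
proof
  assume "eventually (\<lambda>x. \<not> P x) F"
  then show "\<not> eventually P F"
    using assms eventually_conj[of P F "\<lambda>x. \<not> P x"]
    by (auto simp: is_ultrafilter_def trivial_limit_def)
qed (use assms in \<open>auto simp: is_ultrafilter_def\<close>)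

lemma filter_of_principal_ultrafilter [simp]:
  "filter_of (principal_ultrafilter x) = principal {x}"
  by (simp add: principal_ultrafilter_def Abs_ultrafilter_inverse is_ultrafilter_principal)

lemma ultrafilter_eqI:
  assumes "\<And>P. eventually P (filter_of p) \<Longrightarrow> eventually P (filter_of q)"
  shows "p = q"
proof -
  have "eventually P (filter_of p) \<longleftrightarrow> eventually P (filter_of q)" for P
    using assms[of P] assms[of "\<lambda>x. \<not> P x"]
      ultra_not[OF filter_of_ultra, of P p] ultra_not[OF filter_of_ultra, of P q] by blast
  then show ?thesis
    by (simp add: filter_of_inject[symmetric] filter_eq_iff)
qed

lemma ex_ultrafilter_le:
  fixes F :: "'a filter"
  assumes "F \<noteq> bot"
  obtains U where "is_ultrafilter U" "U \<le> F"
proof -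
  let ?A = "{G. G \<noteq> bot \<and> G \<le> F}"
  let ?R = "\<lambda>G H :: 'a filter. H \<le> G"
  have "\<exists>m\<in>?A. \<forall>a\<in>?A. ?R m a \<longrightarrow> a = m"
  proof (rule predicate_Zorn)
    show "partial_order_on ?A (relation_of ?R ?A)"
      by (rule partial_order_on_relation_ofI) auto
    fix C assume C: "C \<in> Chains (relation_of ?R ?A)"
    then have sub: "C \<subseteq> ?A" and tot: "\<And>G H. G \<in> C \<Longrightarrow> H \<in> C \<Longrightarrow> G \<le> H \<or> H \<le> G"
      by (auto simp: Chains_def relation_of_def)
    show "\<exists>u\<in>?A. \<forall>a\<in>C. ?R a u"
    proof (cases "C = {}")
      case True
      then show ?thesis using assms by auto
    next
      case False
      have "\<exists>x\<in>C. x \<le> inf G H" if "G \<in> C" "H \<in> C" for G H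
        using tot[OF that] that by (metis inf.absorb1 inf.absorb2 order_refl)
      then have "eventually (\<lambda>_. False) (Inf C) \<longleftrightarrow> (\<exists>b\<in>C. eventually (\<lambda>_. False) b)"
        using False by (intro eventually_Inf_base)
      then have "\<not> eventually (\<lambda>_. False) (Inf C)"
        using sub by (auto simp: eventually_False)
      then have "Inf C \<noteq> bot" by (simp add: eventually_False)
      moreover have "Inf C \<le> F"
      proof -
        obtain G where "G \<in> C" using False by blast
        then have "Inf C \<le> G" "G \<le> F" using sub by (auto intro: Inf_lower)
        then show ?thesis by (rule order_trans)
      qed
      ultimately show ?thesis by (auto intro!: bexI[of _ "Inf C"] Inf_lower)
    qed
  qed
  then obtain U where U: "U \<noteq> bot" "U \<le> F"
    and max: "\<And>G. G \<noteq> bot \<Longrightarrow> G \<le> F \<Longrightarrow> G \<le> U \<Longrightarrow> G = U" by blast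
  have "eventually P U \<or> eventually (\<lambda>x. \<not> P x) U" for P
  proof (cases "inf U (principal {x. P x}) = bot")
    case True
    then have "eventually (\<lambda>_. False) (inf U (principal {x. P x}))" by simp
    then show ?thesis by (simp add: eventually_inf_principal)
  next
    case False
    then have "inf U (principal {x. P x}) = U"
      using U(2) by (intro max) (auto intro: le_infI1)
    then have "U \<le> principal {x. P x}" by (metis inf.orderI)
    then show ?thesis by (simp add: le_principal)
  qed
  then have "is_ultrafilter U" using U by (simp add: is_ultrafilter_def)
  with U that show thesis by blast
qed

section \<open>The topology\<close>

instantiation ultrafilter :: (type) topological_space
begin

definition open_ultrafilter :: "'a ultrafilter set \<Rightarrow> bool" where
  "open S \<longleftrightarrow> (\<exists>\<A>. S = (\<Union>A\<in>\<A>. stone_set A))"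

lemma open_ultrafilter_iff:
  "open S \<longleftrightarrow> (\<forall>p\<in>S. \<exists>A. p \<in> stone_set A \<and> stone_set A \<subseteq> S)"
proof
  assume R: "\<forall>p\<in>S. \<exists>A. p \<in> stone_set A \<and> stone_set A \<subseteq> S"
  then have "S = (\<Union>A\<in>{A. stone_set A \<subseteq> S}. stone_set A)" by blast
  then show "open S" unfolding open_ultrafilter_def by blast
qed (force simp: open_ultrafilter_def)

lemma stone_set_Int: "stone_set A \<inter> stone_set B = stone_set (A \<inter> B)"
  by (auto simp: stone_set_def eventually_conj_iff)

instance
proof
  show "open (UNIV :: 'a ultrafilter set)"
    by (auto simp: open_ultrafilter_iff stone_set_def intro!: exI[of _ UNIV])
next
  fix S T :: "'a ultrafilter set" assume "open S" "open T"
  then show "open (S \<inter> T)"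
    unfolding open_ultrafilter_iff
    by (metis IntE IntI Int_mono stone_set_Int)
next
  fix K :: "'a ultrafilter set set" assume "\<forall>S\<in>K. open S"
  then show "open (\<Union>K)"
    unfolding open_ultrafilter_iff by (meson UnionE UnionI Union_upper subset_trans)
qed

end

lemma open_stone_set: "open (stone_set A)"
  by (auto simp: open_ultrafilter_iff)

lemma stone_set_Compl: "stone_set (- A) = - stone_set A"
  using ultra_not[OF filter_of_ultra] by (auto simp: stone_set_def)

lemma closed_stone_set: "closed (stone_set A)"
  by (metis closed_def open_stone_set stone_set_Compl)

instance ultrafilter :: (type) t2_space
proof
  fix p q :: "'a ultrafilter" assume "p \<noteq> q"
  then obtain P where "eventually P (filter_of p)" "\<not> eventually P (filter_of q)"
    using ultrafilter_eqI by blast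
  then have "p \<in> stone_set (Collect P)" "q \<in> stone_set (- Collect P)"
    unfolding stone_set_Compl by (auto simp: stone_set_def)
  then show "\<exists>U V. open U \<and> open V \<and> p \<in> U \<and> q \<in> V \<and> U \<inter> V = {}"
    using open_stone_set stone_set_Compl by (metis Compl_disjoint)
qed

lemma ultrafilter_tendsto_iff:
  "(f \<longlongrightarrow> p) F \<longleftrightarrow>
     (\<forall>P. eventually P (filter_of p) \<longrightarrow> eventually (\<lambda>m. eventually P (filter_of (f m))) F)"
proof
  assume L: "(f \<longlongrightarrow> p) F"
  show "\<forall>P. eventually P (filter_of p) \<longrightarrow> eventually (\<lambda>m. eventually P (filter_of (f m))) F"
    using topological_tendstoD[OF L open_stone_set, of "Collect _"]
    by (auto simp: stone_set_def)
next
  assume R: "\<forall>P. eventually P (filter_of p) \<longrightarrow> eventually (\<lambda>m. eventually P (filter_of (f m))) F"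
  show "(f \<longlongrightarrow> p) F"
  proof (rule topological_tendstoI)
    fix S assume "open S" "p \<in> S"
    then obtain A where A: "p \<in> stone_set A" "stone_set A \<subseteq> S"
      by (auto simp: open_ultrafilter_iff)
    then have "eventually (\<lambda>m. f m \<in> stone_set A) F"
      using R by (auto simp: stone_set_def)
    then show "eventually (\<lambda>m. f m \<in> S) F"
      by (rule eventually_mono) (use A in auto)
  qed
qed

lemma ultrafilter_limit:
  fixes f :: "'b \<Rightarrow> 'a ultrafilter"
  assumes "is_ultrafilter F"
  shows "(f \<longlongrightarrow> Lim F f) F"
    and "eventually P (filter_of (Lim F f)) \<longleftrightarrow>
           eventually (\<lambda>m. eventually P (filter_of (f m))) F"
proof -
  define G where "G = Abs_filter (\<lambda>P. eventually (\<lambda>m. eventually P (filter_of (f m))) F)"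
  have ev: "eventually P G \<longleftrightarrow> eventually (\<lambda>m. eventually P (filter_of (f m))) F" for P
    unfolding G_def
  proof (rule eventually_Abs_filter, rule is_filter.intro)
    fix P Q :: "'a \<Rightarrow> bool" assume "\<forall>x. P x \<longrightarrow> Q x"
      and "eventually (\<lambda>m. eventually P (filter_of (f m))) F"
    then show "eventually (\<lambda>m. eventually Q (filter_of (f m))) F"
      by (auto elim!: eventually_mono)
  qed (auto simp: eventually_conj_iff)
  have "\<not> eventually (\<lambda>_. False) G"
    unfolding ev using assms by (simp add: eventually_False is_ultrafilter_def)
  then have "G \<noteq> bot" by (simp add: eventually_False)
  moreover have "eventually P G \<or> eventually (\<lambda>x. \<not> P x) G" for P
    unfolding ev ultra_not[OF filter_of_ultra] using assms unfolding is_ultrafilter_def by blast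
  ultimately have "is_ultrafilter G" by (simp add: is_ultrafilter_def)
  then obtain p where p: "filter_of p = G"
    using Abs_ultrafilter_inverse by blast
  have lim: "(f \<longlongrightarrow> p) F" by (simp add: ultrafilter_tendsto_iff p ev)
  then have "Lim F f = p"
    using assms by (intro tendsto_Lim) (auto simp: is_ultrafilter_def)
  with lim p ev show "(f \<longlongrightarrow> Lim F f) F"
    and "eventually P (filter_of (Lim F f)) \<longleftrightarrow>
           eventually (\<lambda>m. eventually P (filter_of (f m))) F" by auto
qed

lemma compact_UNIV_ultrafilter: "compact (UNIV :: 'a ultrafilter set)"
  unfolding compact_filter
proof (intro allI impI)
  fix F :: "'a ultrafilter filter" assume "F \<noteq> bot"
  then obtain U where U: "is_ultrafilter U" "U \<le> F" by (rule ex_ultrafilter_le)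
  define x where "x = Lim U (\<lambda>p. p)"
  have "U \<le> nhds x"
    using ultrafilter_limit(1)[OF U(1), of "\<lambda>p. p"] by (simp add: x_def filterlim_def filtermap_ident)
  with U have "U \<le> inf (nhds x) F" "U \<noteq> bot" by (auto simp: is_ultrafilter_def)
  then show "\<exists>x\<in>UNIV. inf (nhds x) F \<noteq> bot" by (metis UNIV_I le_bot)
qed

section \<open>Addition\<close>

instantiation ultrafilter :: (plus) plus
begin

definition plus_ultrafilter :: "'a ultrafilter \<Rightarrow> 'a ultrafilter \<Rightarrow> 'a ultrafilter" where
  "q + p = Lim (filter_of q) (\<lambda>m. Lim (filter_of p) (\<lambda>n. principal_ultrafilter (m + n)))"

instance ..

end

lemma eventually_plus_ultrafilter:
  "eventually P (filter_of (q + p)) \<longleftrightarrow>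
     eventually (\<lambda>m. eventually (\<lambda>n. P (m + n)) (filter_of p)) (filter_of q)"
  by (simp add: plus_ultrafilter_def ultrafilter_limit(2)[OF filter_of_ultra]
      eventually_principal)

instance ultrafilter :: (semigroup_add) semigroup_add
  by standard (auto intro!: ultrafilter_eqI simp: eventually_plus_ultrafilter add.assoc)

section \<open>The smallest two-sided ideal\<close>

definition two_sided_ideal :: "'a :: semigroup_add set \<Rightarrow> bool" where
  "two_sided_ideal I \<longleftrightarrow> I \<noteq> {} \<and> (\<forall>p. \<forall>x\<in>I. p + x \<in> I \<and> x + p \<in> I)"

definition minimal_two_sided_ideal :: "'a :: semigroup_add set \<Rightarrow> bool" where
  "minimal_two_sided_ideal K \<longleftrightarrow>
     two_sided_ideal K \<and> (\<forall>I. two_sided_ideal I \<and> I \<subseteq> K \<longrightarrow> I = K)"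

text \<open>Well defined by \<open>ex1_minimal_two_sided_ideal\<close> below.\<close>

definition kappa :: "nat ultrafilter set" where
  "kappa = (THE K. minimal_two_sided_ideal K)"

lemma continuous_plus_left:
  fixes p :: "'a :: plus ultrafilter"
  shows "continuous_on UNIV (\<lambda>q. q + p)"
proof -
  have "((\<lambda>q. q + p) \<longlongrightarrow> q0 + p) (nhds q0)" for q0
    unfolding ultrafilter_tendsto_iff eventually_plus_ultrafilter
  proof (intro allI impI)
    fix P assume "eventually (\<lambda>m. eventually (\<lambda>n. P (m + n)) (filter_of p)) (filter_of q0)"
    then have "q0 \<in> stone_set {m. eventually (\<lambda>n. P (m + n)) (filter_of p)}"
      by (simp add: stone_set_def)
    then have "eventually (\<lambda>q. q \<in> stone_set {m. eventually (\<lambda>n. P (m + n)) (filter_of p)}) (nhds q0)"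
      using open_stone_set by (rule eventually_nhds_in_open[rotated])
    then show "eventually (\<lambda>q. eventually (\<lambda>m. eventually (\<lambda>n. P (m + n)) (filter_of p)) (filter_of q)) (nhds q0)"
      by (simp add: stone_set_def)
  qed
  then show ?thesis
    by (simp add: continuous_on_def tendsto_mono[OF at_le] filterlim_mono at_within_def)
      (meson filterlim_mono inf_le1 order_refl)
qed

lemma ex_least_two_sided_ideal:
  "\<exists>K :: 'a :: semigroup_add ultrafilter set.
     two_sided_ideal K \<and> (\<forall>I. two_sided_ideal I \<longrightarrow> K \<subseteq> I)"
proof -
  let ?A = "{L :: 'a ultrafilter set. L \<noteq> {} \<and> closed L \<and> (\<forall>p. \<forall>x\<in>L. p + x \<in> L)}"
  let ?R = "\<lambda>L M :: 'a ultrafilter set. M \<subseteq> L"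
  have "\<exists>m\<in>?A. \<forall>a\<in>?A. ?R m a \<longrightarrow> a = m"
  proof (rule predicate_Zorn)
    show "partial_order_on ?A (relation_of ?R ?A)"
      by (rule partial_order_on_relation_ofI) auto
    fix C assume "C \<in> Chains (relation_of ?R ?A)"
    then have chain: "(G, H) \<in> relation_of ?R ?A \<or> (H, G) \<in> relation_of ?R ?A"
      if "G \<in> C" "H \<in> C" for G H
      using that by (simp only: Chains_def mem_Collect_eq)
    have sub: "C \<subseteq> ?A"
      using chain by (auto simp: relation_of_def)
    have tot: "G \<subseteq> H \<or> H \<subseteq> G" if "G \<in> C" "H \<in> C" for G H
      using chain[OF that] by (auto simp: relation_of_def)
    have fin: "UNIV \<inter> \<Inter>D \<noteq> {}" if "finite D" "D \<subseteq> C" for D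
    proof (cases "D = {}")
      case False
      have "\<Inter>D \<in> D"
        using that(1) False that(2)
      proof (induction D rule: finite_ne_induct)
        case (insert G D)
        then have "\<Inter>D \<in> D" "G \<subseteq> \<Inter>D \<or> \<Inter>D \<subseteq> G" using tot by auto
        then have "G \<inter> \<Inter>D = G \<or> G \<inter> \<Inter>D = \<Inter>D" 
          by (metis Int_absorb1 Int_absorb2)
        with \<open>\<Inter>D \<in> D\<close> show ?case by (metis Inter_insert insert_iff)
      qed simp
      then have "\<Inter>D \<in> ?A" using that(2) sub by (meson subsetD)
      then show ?thesis by auto
    qed simp
    have "UNIV \<inter> \<Inter>C \<noteq> {}"
    proof (rule compact_imp_fip[OF compact_UNIV_ultrafilter])
      show "closed T" if "T \<in> C" for T using that sub by auto
    qed (rule fin)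
    moreover have "closed (\<Inter>C)" using sub by (intro closed_Inter) auto
    moreover have "p + x \<in> \<Inter>C" if "x \<in> \<Inter>C" for p x
    proof
      fix L assume "L \<in> C"
      then have "x \<in> L" "L \<in> ?A" using that sub by auto
      then show "p + x \<in> L" by simp
    qed
    ultimately have "\<Inter>C \<in> ?A" by simp
    then show "\<exists>u\<in>?A. \<forall>a\<in>C. ?R a u" by (meson Inter_lower)
  qed
  then obtain L where "L \<in> ?A" and L_min: "\<forall>M\<in>?A. M \<subseteq> L \<longrightarrow> M = L"
    by (rule bexE)
  then have L: "L \<noteq> {}" "closed L" "\<And>p x. x \<in> L \<Longrightarrow> p + x \<in> L" by auto
  have min: "M = L" if "M \<in> ?A" "M \<subseteq> L" for M
    by (rule L_min[rule_format, OF that])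
  have gen: "range (\<lambda>q. q + x) = L" if "x \<in> L" for x
  proof (rule min)
    have "closed (range (\<lambda>q. q + x))"
      by (intro compact_imp_closed compact_continuous_image continuous_plus_left
          compact_UNIV_ultrafilter)
    then show "range (\<lambda>q. q + x) \<in> ?A"
      by (auto simp: add.assoc[symmetric])
  qed (use L that in auto)
  define K where "K = {l + q | l q. l \<in> L}"
  have "two_sided_ideal K"
    unfolding two_sided_ideal_def
  proof (intro conjI allI ballI)
    show "K \<noteq> {}" using L(1) by (auto simp: K_def)
    fix p x assume "x \<in> K"
    then obtain l q where x: "x = l + q" "l \<in> L" by (auto simp: K_def)
    have "p + x = (p + l) + q" "x + p = l + (q + p)" by (simp_all add: x add.assoc)
    then show "p + x \<in> K" "x + p \<in> K" using x L(3) unfolding K_def by blast+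
  qed
  moreover have "K \<subseteq> I" if I: "two_sided_ideal I" for I
  proof -
    obtain x l where "x \<in> I" "l \<in> L" using I L(1) by (auto simp: two_sided_ideal_def)
    then have "x + l \<in> I" "x + l \<in> L" using I L(3) by (auto simp: two_sided_ideal_def)
    with gen[of "x + l"] I have "L \<subseteq> I" by (auto simp: two_sided_ideal_def)
    then show ?thesis using I by (auto simp: K_def two_sided_ideal_def)
  qed
  ultimately show ?thesis by blast
qed

lemma ex1_minimal_two_sided_ideal:
  "\<exists>!K :: 'a :: semigroup_add ultrafilter set. minimal_two_sided_ideal K"
proof -
  obtain K :: "'a ultrafilter set"
    where K: "two_sided_ideal K" "\<And>I. two_sided_ideal I \<Longrightarrow> K \<subseteq> I"
    using ex_least_two_sided_ideal by blast
  show ?thesis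
  proof (rule ex1I[of _ K])
    show "minimal_two_sided_ideal K"
      using K unfolding minimal_two_sided_ideal_def by blast
  qed (use K in \<open>metis minimal_two_sided_ideal_def\<close>)
qed

lemma kappa_ideal: "two_sided_ideal kappa"
  and kappa_least: "two_sided_ideal I \<Longrightarrow> kappa \<subseteq> I"
proof -
  have m: "minimal_two_sided_ideal kappa"
    unfolding kappa_def by (rule theI'[OF ex1_minimal_two_sided_ideal])
  then show "two_sided_ideal kappa" by (simp add: minimal_two_sided_ideal_def)
  obtain K :: "nat ultrafilter set"
    where K: "two_sided_ideal K" "\<And>I. two_sided_ideal I \<Longrightarrow> K \<subseteq> I"
    using ex_least_two_sided_ideal by blast
  with m have "K = kappa" by (simp add: minimal_two_sided_ideal_def)
  with K(2) show "two_sided_ideal I \<Longrightarrow> kappa \<subseteq> I" by simp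
qed

section \<open>Counting measures\<close>

text \<open>Outer regularity is not required separately: on a compact Hausdorff space it follows
  from finiteness and inner regularity.\<close>

definition radon_measure :: "'a :: topological_space measure \<Rightarrow> bool" where
  "radon_measure \<mu> \<longleftrightarrow>
     sets \<mu> = sets borel \<and>
     (\<forall>K. compact K \<longrightarrow> emeasure \<mu> K < \<infinity>) \<and>
     (\<forall>B\<in>sets borel. emeasure \<mu> B = (SUP K\<in>{K. compact K \<and> K \<subseteq> B}. emeasure \<mu> K))"

text \<open>A pair \<open>(N, M)\<close> stands for the interval \<open>{M+1..M+N}\<close> of length \<open>N > 0\<close>. Ultrafilters on
  the set of such pairs are represented as the ultrafilters on \<open>nat \<times> nat\<close> containing that set.\<close>

definition averaging_ultrafilter :: "(nat \<times> nat) ultrafilter \<Rightarrow> bool" where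
  "averaging_ultrafilter q \<longleftrightarrow>
     q \<in> stone_set ({0<..} \<times> UNIV) \<and>
     ((\<lambda>(N, M). 1 / real N) \<longlongrightarrow> 0) (filter_of q) \<and>
     ((\<exists>M0. ((\<lambda>(N, M). M) \<longlongrightarrow> M0) (filter_of q)) \<or>
      (\<exists>Ns Ms :: nat \<Rightarrow> nat.
         (\<forall>i. Ns i > 0 \<and> Ms i + Ns i < Ms (Suc i) \<and> Ns i < Ns (Suc i)) \<and>
         q \<in> stone_set (range (\<lambda>i. (Ns i, Ms i)))))"

definition counting_measure :: "nat ultrafilter measure \<Rightarrow> bool" where
  "counting_measure \<mu> \<longleftrightarrow>
     radon_measure \<mu> \<and>
     (\<exists>q. averaging_ultrafilter q \<and>
        (\<forall>A. ((\<lambda>(N, M). real (card (A \<inter> {M+1..M+N})) / real N)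
              \<longlongrightarrow> measure \<mu> (stone_set A)) (filter_of q)))"

end

theory Submission
  imports Defs
begin

text \<open>
  The minimal ideal lies in \<open>stone_set B\<close> for every set \<open>B\<close> that is thickly syndetic, that is,
  contains blocks of every given length with bounded gaps between them. The reason is that the
  thickly syndetic sets form a proper filter which is invariant under shifts by naturals and, in
  a suitable sense, by ultrafilters. The ultrafilters refining this filter therefore form a
  two-sided ideal, and \<open>kappa\<close> is contained in every two-sided ideal
  (\<open>kappa_subset_stone_set\<close>).

  It remains to find thickly syndetic sets of small measure. Starting at every multiple of a
  period \<open>P k\<close>, put a block of length \<open>k\<close>, for each \<open>k\<close>, where the periods grow so fast that
  \<open>\<Sum>k. k / P k\<close> is small. A thickly syndetic set still contains long intervals, so it can fill
  some windows completely and no bound holds for all windows. But a counting measure averages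
  over restricted windows: those reaching far out are long, because their starting points
  are bounded or because they are disjoint and growing (\<open>averaging_windows_long\<close>). If the blocks
  of period \<open>P k\<close> are used only so far out that every window reaching them has length at least
  \<open>P k\<close>, each window sees each kind of block at most with a constant times its natural
  density. So the set has measure at most a constant times \<open>\<Sum>k. k / P k\<close>. Intersecting such
  closed sets with smaller and smaller measures gives a null set containing \<open>kappa\<close>.
\<close>

section \<open>Thickly syndetic sets and the minimal ideal\<close>

definition thickly_syndetic :: "nat set \<Rightarrow> bool" where
  "thickly_syndetic S \<longleftrightarrow> (\<forall>k. \<exists>d. \<forall>x. \<exists>y\<in>{x..x + d}. {y..<y + k} \<subseteq> S)"

lemma thickly_syndeticE:
  assumes "thickly_syndetic S"
  obtains d where "\<And>x. \<exists>y\<in>{x..x + d}. {y..<y + k} \<subseteq> S"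
  using assms unfolding thickly_syndetic_def by meson

text \<open>Initial segments do not matter: the gap bound can absorb the threshold.\<close>

lemma thickly_syndeticI_threshold:
  assumes "\<And>k. \<exists>d t. \<forall>x\<ge>t. \<exists>y\<in>{x..x + d}. {y..<y + k} \<subseteq> S"
  shows "thickly_syndetic S"
  unfolding thickly_syndetic_def
proof
  fix k
  obtain d t where dt: "\<And>x. x \<ge> t \<Longrightarrow> \<exists>y\<in>{x..x + d}. {y..<y + k} \<subseteq> S"
    using assms[of k] by blast
  have "\<exists>y\<in>{x..x + (t + d)}. {y..<y + k} \<subseteq> S" for x
    using dt[of "x + t"] by fastforce
  then show "\<exists>d. \<forall>x. \<exists>y\<in>{x..x + d}. {y..<y + k} \<subseteq> S" by blast
qed

lemma thickly_syndetic_mono: "thickly_syndetic S \<Longrightarrow> S \<subseteq> S' \<Longrightarrow> thickly_syndetic S'"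
  unfolding thickly_syndetic_def by (meson subset_trans)

text \<open>A block of \<open>S'\<close> whose length exceeds the gap bound of \<open>S\<close> contains a block of \<open>S\<close>.\<close>

lemma thickly_syndetic_Int:
  assumes "thickly_syndetic S" "thickly_syndetic S'"
  shows "thickly_syndetic (S \<inter> S')"
  unfolding thickly_syndetic_def
proof
  fix k
  obtain d where d: "\<And>x. \<exists>y\<in>{x..x + d}. {y..<y + k} \<subseteq> S"
    using thickly_syndeticE[OF assms(1)] by blast
  obtain d' where d': "\<And>x. \<exists>y\<in>{x..x + d'}. {y..<y + (d + k)} \<subseteq> S'"
    using thickly_syndeticE[OF assms(2)] by blast
  have "\<exists>y\<in>{x..x + (d' + d)}. {y..<y + k} \<subseteq> S \<inter> S'" for x
  proof -
    obtain y' where y': "y' \<in> {x..x + d'}" "{y'..<y' + (d + k)} \<subseteq> S'" using d' by blast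
    obtain y where y: "y \<in> {y'..y' + d}" "{y..<y + k} \<subseteq> S" using d by blast
    have "{y..<y + k} \<subseteq> {y'..<y' + (d + k)}" using y(1) by auto
    with y y' have "y \<in> {x..x + (d' + d)}" "{y..<y + k} \<subseteq> S \<inter> S'" by auto
    then show ?thesis by blast
  qed
  then show "\<exists>d. \<forall>x. \<exists>y\<in>{x..x + d}. {y..<y + k} \<subseteq> S \<inter> S'" by blast
qed

lemma thickly_syndetic_shift:
  assumes "thickly_syndetic S"
  shows "thickly_syndetic {n. m + n \<in> S}"
  unfolding thickly_syndetic_def
proof
  fix k
  obtain d where d: "\<And>x. \<exists>y\<in>{x..x + d}. {y..<y + k} \<subseteq> S"
    using thickly_syndeticE[OF assms] by blast
  have "\<exists>y\<in>{x..x + d}. {y..<y + k} \<subseteq> {n. m + n \<in> S}" for x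
  proof -
    obtain y where y: "y \<in> {m + x..m + x + d}" "{y..<y + k} \<subseteq> S" using d by blast
    then have "m + n \<in> {y..<y + k}" if "n \<in> {y - m..<y - m + k}" for n
      using that by auto
    with y have "y - m \<in> {x..x + d}" "{y - m..<y - m + k} \<subseteq> {n. m + n \<in> S}" by auto
    then show ?thesis by blast
  qed
  then show "\<exists>d. \<forall>x. \<exists>y\<in>{x..x + d}. {y..<y + k} \<subseteq> {n. m + n \<in> S}" by blast
qed

lemma ultrafilter_finite_pigeonhole:
  assumes "finite Y" "\<And>l. \<exists>y\<in>Y. Q y l"
  shows "\<exists>y\<in>Y. eventually (Q y) (filter_of c)"
proof (rule ccontr)
  assume "\<not> ?thesis"
  then have "\<forall>y\<in>Y. eventually (\<lambda>l. \<not> Q y l) (filter_of c)"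
    by (simp add: ultra_not[OF filter_of_ultra])
  then have "eventually (\<lambda>l. \<forall>y\<in>Y. \<not> Q y l) (filter_of c)"
    by (simp add: eventually_ball_finite assms(1))
  then have "eventually (\<lambda>l. False) (filter_of c)"
    by (rule eventually_mono) (use assms(2) in blast)
  then show False by (simp add: eventually_False)
qed

text \<open>
  For each \<open>l\<close>, some block of \<open>S\<close> starts in \<open>{x + l..x + d + l}\<close>. Relative to \<open>l\<close>, its starting
  point takes only \<open>d + 1\<close> values, so \<open>c\<close> selects one of them.
\<close>

lemma thickly_syndetic_ultrafilter_shift:
  assumes "thickly_syndetic S"
  shows "thickly_syndetic {n. eventually (\<lambda>l. n + l \<in> S) (filter_of c)}"
  unfolding thickly_syndetic_def
proof
  fix k
  obtain d where d: "\<And>x. \<exists>y\<in>{x..x + d}. {y..<y + k} \<subseteq> S"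
    using thickly_syndeticE[OF assms] by blast
  have "\<exists>y\<in>{x..x + d}. {y..<y + k} \<subseteq> {n. eventually (\<lambda>l. n + l \<in> S) (filter_of c)}" for x
  proof -
    have "\<exists>y\<in>{x..x + d}. {y + l..<y + l + k} \<subseteq> S" for l
    proof -
      obtain y where y: "y \<in> {x + l..x + l + d}" "{y..<y + k} \<subseteq> S" using d by blast
      then have "y - l \<in> {x..x + d}" "{y - l + l..<y - l + l + k} \<subseteq> S" by auto
      then show ?thesis by blast
    qed
    then obtain y where y: "y \<in> {x..x + d}"
        "eventually (\<lambda>l. {y + l..<y + l + k} \<subseteq> S) (filter_of c)"
      using ultrafilter_finite_pigeonhole[of "{x..x + d}" "\<lambda>y l. {y + l..<y + l + k} \<subseteq> S" c]
      by auto
    have "eventually (\<lambda>l. n + l \<in> S) (filter_of c)" if "n \<in> {y..<y + k}" for n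
      by (rule eventually_mono[OF y(2)]) (use that in auto)
    with y(1) show ?thesis by blast
  qed
  then show "\<exists>d. \<forall>x. \<exists>y\<in>{x..x + d}.
      {y..<y + k} \<subseteq> {n. eventually (\<lambda>l. n + l \<in> S) (filter_of c)}" by blast
qed

definition thickly_syndetic_filter :: "nat filter" where
  "thickly_syndetic_filter = Abs_filter (\<lambda>P. thickly_syndetic {n. P n})"

lemma eventually_thickly_syndetic_filter:
  "eventually P thickly_syndetic_filter \<longleftrightarrow> thickly_syndetic {n. P n}"
  unfolding thickly_syndetic_filter_def
proof (rule eventually_Abs_filter, rule is_filter.intro)
  show "thickly_syndetic {n. True}"
    unfolding thickly_syndetic_def by (fastforce intro: exI[of _ 0])
next
  fix P Q assume "thickly_syndetic {n. P n}" "thickly_syndetic {n. Q n}"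
  then show "thickly_syndetic {n. P n \<and> Q n}"
    using thickly_syndetic_Int by (simp add: Collect_conj_eq)
next
  fix P Q :: "nat \<Rightarrow> bool" assume "\<forall>n. P n \<longrightarrow> Q n" "thickly_syndetic {n. P n}"
  then show "thickly_syndetic {n. Q n}"
    by (auto elim: thickly_syndetic_mono)
qed

lemma thickly_syndetic_filter_neq_bot: "thickly_syndetic_filter \<noteq> bot"
proof -
  have "\<not> thickly_syndetic {}"
    by (auto simp: thickly_syndetic_def intro!: exI[of _ 1])
  then show ?thesis
    by (simp add: eventually_False[symmetric] eventually_thickly_syndetic_filter)
qed

text \<open>
  Closure under sums \<open>p + x\<close> comes from the invariance of thickly syndetic sets under shifts by
  naturals, closure under \<open>x + p\<close> from the invariance under shifts by ultrafilters.
\<close>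

lemma two_sided_ideal_thickly_syndetic:
  "two_sided_ideal {p. filter_of p \<le> thickly_syndetic_filter}"
  unfolding two_sided_ideal_def
proof (intro conjI allI ballI)
  obtain U where U: "is_ultrafilter U" "U \<le> thickly_syndetic_filter"
    using ex_ultrafilter_le[OF thickly_syndetic_filter_neq_bot] .
  then have "filter_of (Abs_ultrafilter U) \<le> thickly_syndetic_filter"
    by (simp add: Abs_ultrafilter_inverse)
  then show "{p. filter_of p \<le> thickly_syndetic_filter} \<noteq> {}" by blast
next
  fix p x assume "x \<in> {p. filter_of p \<le> thickly_syndetic_filter}"
  then have x: "eventually P (filter_of x)" if "thickly_syndetic {n. P n}" for P
    using that by (auto simp: le_filter_def eventually_thickly_syndetic_filter)
  show "p + x \<in> {p. filter_of p \<le> thickly_syndetic_filter}"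
    unfolding mem_Collect_eq le_filter_def eventually_thickly_syndetic_filter
      eventually_plus_ultrafilter
  proof (intro allI impI)
    fix P assume "thickly_syndetic {n. P n}"
    then have "thickly_syndetic {n. P (m + n)}" for m
      using thickly_syndetic_shift[of "{n. P n}" m] by simp
    then show "eventually (\<lambda>m. eventually (\<lambda>n. P (m + n)) (filter_of x)) (filter_of p)"
      by (simp add: x)
  qed
  show "x + p \<in> {p. filter_of p \<le> thickly_syndetic_filter}"
    unfolding mem_Collect_eq le_filter_def eventually_thickly_syndetic_filter
      eventually_plus_ultrafilter
  proof (intro allI impI x)
    fix P assume "thickly_syndetic {n. P n}"
    from thickly_syndetic_ultrafilter_shift[OF this, of p]
    show "thickly_syndetic {m. eventually (\<lambda>n. P (m + n)) (filter_of p)}" by simp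
  qed
qed

lemma kappa_subset_stone_set:
  assumes "thickly_syndetic S"
  shows "kappa \<subseteq> stone_set S"
proof -
  have "eventually (\<lambda>n. n \<in> S) thickly_syndetic_filter"
    using assms by (simp add: eventually_thickly_syndetic_filter)
  then show ?thesis
    using kappa_least[OF two_sided_ideal_thickly_syndetic]
    by (auto simp: stone_set_def dest: filter_leD)
qed

section \<open>Sparse thickly syndetic sets\<close>

definition periodic_blocks :: "(nat \<Rightarrow> nat) \<Rightarrow> (nat \<Rightarrow> nat) \<Rightarrow> nat set" where
  "periodic_blocks P T = {n. \<exists>k. T (P k) \<le> n \<and> n mod P k < k}"

lemma thickly_syndetic_periodic_blocks:
  assumes "\<And>k. k < P k"
  shows "thickly_syndetic (periodic_blocks P T)"
proof (rule thickly_syndeticI_threshold)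
  fix k
  have "\<exists>y\<in>{x..x + P k}. {y..<y + k} \<subseteq> periodic_blocks P T" if "T (P k) \<le> x" for x
  proof
    let ?y = "P k * Suc (x div P k)"
    have "x = P k * (x div P k) + x mod P k" "x mod P k < P k"
      using assms[of k] by simp_all
    then show y: "?y \<in> {x..x + P k}" by (simp only: mult_Suc_right atLeastAtMost_iff) linarith
    show "{?y..<?y + k} \<subseteq> periodic_blocks P T"
    proof
      fix n assume n: "n \<in> {?y..<?y + k}"
      then obtain j where j: "n = ?y + j" "j < k"
        by (auto simp del: mult_Suc_right simp: le_iff_add)
      then have "n mod P k = j"
        using assms[of k] by (simp del: mult_Suc_right)
      moreover have "T (P k) \<le> n"
        using that y j by (simp del: mult_Suc_right)
      ultimately show "n \<in> periodic_blocks P T"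
        using j(2) by (auto simp: periodic_blocks_def)
    qed
  qed
  then show "\<exists>d t. \<forall>x\<ge>t. \<exists>y\<in>{x..x + d}. {y..<y + k} \<subseteq> periodic_blocks P T" by blast
qed

text \<open>
  A window of length \<open>N \<ge> p\<close> meets at most \<open>N / p + 2 \<le> 3 * N / p\<close> periods, and each contributes at
  most \<open>k\<close> elements.
\<close>

lemma card_residue_block_le:
  fixes k p M N :: nat
  assumes "0 < p" "p \<le> N"
  shows "real (card {n\<in>{M + 1..M + N}. n mod p < k}) \<le> 3 * real k * real N / real p"
proof -
  let ?A = "{n\<in>{M + 1..M + N}. n mod p < k}"
  let ?D = "{M div p..(M + N) div p}"
  have "card ?A \<le> card (?D \<times> {..<k})"
  proof (rule card_inj_on_le)
    show "inj_on (\<lambda>n. (n div p, n mod p)) ?A"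
      by (rule inj_onI) (metis div_mult_mod_eq prod.inject)
    show "(\<lambda>n. (n div p, n mod p)) ` ?A \<subseteq> ?D \<times> {..<k}"
      by (clarsimp simp: div_le_mono)
  qed simp
  also have "\<dots> \<le> (N div p + 2) * k"
  proof -
    have "M + N = (M div p + N div p) * p + (M mod p + N mod p)"
      by (simp add: algebra_simps)
    also have "\<dots> < (M div p + N div p) * p + 2 * p"
      using mod_less_divisor[OF assms(1), of M] mod_less_divisor[OF assms(1), of N] by linarith
    also have "\<dots> = (M div p + N div p + 2) * p"
      by (simp add: distrib_right)
    finally have "(M + N) div p < M div p + N div p + 2"
      using assms(1) by (simp add: div_less_iff_less_mult)
    then have "card ?D \<le> N div p + 2" by simp
    then show ?thesis
      unfolding card_cartesian_product card_lessThan by (rule mult_right_mono) simp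
  qed
  also have "real \<dots> \<le> 3 * (real N / real p) * real k"
  proof -
    have "1 \<le> real N / real p" using assms by simp
    moreover have "real (N div p) \<le> real N / real p" by (rule of_nat_div_le_of_nat)
    ultimately have "real (N div p + 2) \<le> 3 * (real N / real p)" by simp
    then show ?thesis by (simp only: of_nat_mult) (rule mult_right_mono, auto)
  qed
  finally show ?thesis by (simp add: mult_ac)
qed

text \<open>
  The factor \<open>k + 1\<close> compensates the block length, so that the densities are dominated by a
  geometric series; \<open>r + 1\<close> makes its sum small.
\<close>

definition sparse_period :: "nat \<Rightarrow> nat \<Rightarrow> nat" where
  "sparse_period r k = Suc k * (Suc r * 2 ^ k)"

lemma less_sparse_period: "k < sparse_period r k"
proof -
  have "Suc k * 1 \<le> sparse_period r k"
    unfolding sparse_period_def by (intro mult_le_mono) (auto simp: Suc_le_eq)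
  then show ?thesis by simp
qed

lemma sum_inverse_powers_2_le: "(\<Sum>k<n. 1 / 2 ^ k :: real) \<le> 2"
proof -
  have "(\<Sum>k<n. 1 / 2 ^ k :: real) = 2 - 2 / 2 ^ n"
    by (induction n) (auto simp: field_simps)
  then show ?thesis by simp
qed

lemma density_periodic_blocks_le:
  assumes window: "\<And>p. T p \<le> M + N \<Longrightarrow> p \<le> N"
  shows "real (card (periodic_blocks (sparse_period r) T \<inter> {M + 1..M + N})) / real N
           \<le> 6 / real (Suc r)"
proof (cases "N = 0")
  case False
  define P where "P = sparse_period r"
  define K where "K = {k\<in>{..<N}. P k \<le> N}"
  define C where "C k = {n\<in>{M + 1..M + N}. n mod P k < k}" for k
  \<comment> \<open>The threshold keeps blocks with a period longer than the window out of it.\<close>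
  have "periodic_blocks P T \<inter> {M + 1..M + N} \<subseteq> (\<Union>k\<in>K. C k)"
  proof
    fix n assume "n \<in> periodic_blocks P T \<inter> {M + 1..M + N}"
    then obtain k where n: "T (P k) \<le> n" "n mod P k < k" "n \<in> {M + 1..M + N}"
      by (auto simp: periodic_blocks_def)
    then have "P k \<le> N" by (intro window) auto
    moreover from this have "k < N"
      using less_sparse_period[of k r] by (simp add: P_def)
    ultimately show "n \<in> (\<Union>k\<in>K. C k)" using n by (auto simp: K_def C_def)
  qed
  then have "card (periodic_blocks P T \<inter> {M + 1..M + N}) \<le> card (\<Union>k\<in>K. C k)"
    by (intro card_mono) (auto simp: K_def C_def)
  also have "\<dots> \<le> (\<Sum>k\<in>K. card (C k))"
    by (rule card_UN_le) (simp add: K_def)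
  finally have "real (card (periodic_blocks P T \<inter> {M + 1..M + N})) \<le> (\<Sum>k\<in>K. real (card (C k)))"
    by (metis of_nat_le_iff of_nat_sum)
  also have "\<dots> \<le> (\<Sum>k\<in>K. 3 * real N / real (Suc r) * (1 / 2 ^ k))"
  proof (rule sum_mono)
    fix k assume "k \<in> K"
    then have "real (card (C k)) \<le> 3 * real k * real N / real (P k)"
      unfolding C_def using less_sparse_period[of k r]
      by (intro card_residue_block_le) (auto simp: K_def P_def)
    also have "\<dots> = real k / real (Suc k) * (3 * real N / real (Suc r) * (1 / 2 ^ k))"
      by (simp only: P_def sparse_period_def of_nat_mult of_nat_power of_nat_numeral)
        (simp only: times_divide_times_eq mult_ac mult_1_right)
    also have "\<dots> \<le> 1 * (3 * real N / real (Suc r) * (1 / 2 ^ k))"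
      by (rule mult_right_mono) auto
    finally show "real (card (C k)) \<le> 3 * real N / real (Suc r) * (1 / 2 ^ k)" by simp
  qed
  also have "\<dots> \<le> (\<Sum>k<N. 3 * real N / real (Suc r) * (1 / 2 ^ k))"
    by (rule sum_mono2) (auto simp: K_def)
  also have "\<dots> = 3 * real N / real (Suc r) * (\<Sum>k<N. 1 / 2 ^ k)"
    by (simp add: sum_distrib_left)
  also have "\<dots> \<le> 3 * real N / real (Suc r) * 2"
    by (rule mult_left_mono[OF sum_inverse_powers_2_le]) simp
  finally show ?thesis
    using False by (simp add: P_def field_simps)
qed simp

section \<open>Windows of counting measures\<close>

text \<open>
  If the starting points are bounded by \<open>M0\<close>, a window reaching \<open>M0 + p\<close> has length at least \<open>p\<close>.
  In a sequence of disjoint windows of increasing length, only those with index at least \<open>p\<close>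
  reach \<open>Ms p\<close>, and window \<open>i\<close> has length at least \<open>i\<close>.
\<close>

lemma averaging_windows_long:
  assumes "averaging_ultrafilter q"
  obtains T where "eventually (\<lambda>(N, M). \<forall>p. T p \<le> M + N \<longrightarrow> p \<le> N) (filter_of q)"
proof -
  consider M0 where "((\<lambda>(N, M). M) \<longlongrightarrow> M0) (filter_of q)"
    | Ns Ms :: "nat \<Rightarrow> nat" where
        "\<And>i. Ms i + Ns i < Ms (Suc i)" "\<And>i. Ns i < Ns (Suc i)"
        "q \<in> stone_set (range (\<lambda>i. (Ns i, Ms i)))"
    using assms unfolding averaging_ultrafilter_def by blast
  then show thesis
  proof cases
    case 1
    then have "eventually (\<lambda>(N, M). M = M0) (filter_of q)"
      by (simp add: tendsto_discrete case_prod_unfold)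
    then have "eventually (\<lambda>(N, M). \<forall>p. M0 + p \<le> M + N \<longrightarrow> p \<le> N) (filter_of q)"
      by (rule eventually_mono) auto
    then show thesis by (rule that)
  next
    case 2
    have "strict_mono Ns" using 2(2) by (simp add: strict_mono_Suc_iff)
    then have Ns: "i \<le> Ns i" for i by (rule strict_mono_imp_increasing)
    have Ms: "incseq Ms"
      using 2(1) by (intro incseq_SucI) (meson add_leE less_imp_le)
    have "p \<le> Ns i" if "Ms p \<le> Ms i + Ns i" for p i
    proof -
      have "\<not> Suc i \<le> p"
        using that 2(1)[of i] incseqD[OF Ms, of "Suc i" p] by linarith
      then show ?thesis using Ns[of i] by simp
    qed
    moreover have "eventually (\<lambda>x. x \<in> range (\<lambda>i. (Ns i, Ms i))) (filter_of q)"
      using 2(3) by (simp add: stone_set_def)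
    ultimately have "eventually (\<lambda>(N, M). \<forall>p. Ms p \<le> M + N \<longrightarrow> p \<le> N) (filter_of q)"
      by (auto elim!: eventually_mono)
    then show thesis by (rule that)
  qed
qed

theorem theorem4p3p4:
  fixes \<mu> :: "nat ultrafilter measure"
  assumes "counting_measure \<mu>"
  shows "\<exists>B\<in>null_sets \<mu>. kappa \<subseteq> B"
proof -
  obtain q where radon: "radon_measure \<mu>" and q: "averaging_ultrafilter q"
    and lim: "\<And>A. ((\<lambda>(N, M). real (card (A \<inter> {M+1..M+N})) / real N)
                    \<longlongrightarrow> measure \<mu> (stone_set A)) (filter_of q)"
    using assms unfolding counting_measure_def by blast
  obtain T where T: "eventually (\<lambda>(N, M). \<forall>p. T p \<le> M + N \<longrightarrow> p \<le> N) (filter_of q)"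
    using q by (rule averaging_windows_long)
  define S where "S r = periodic_blocks (sparse_period r) T" for r
  have sets: "sets \<mu> = sets borel" using radon by (simp add: radon_measure_def)
  have "emeasure \<mu> UNIV < \<infinity>"
    using radon compact_UNIV_ultrafilter unfolding radon_measure_def by blast
  then interpret finite_measure \<mu>
    using sets_eq_imp_space_eq[OF sets] by (intro finite_measureI) auto
  have meas: "stone_set (S r) \<in> sets \<mu>" for r
    by (simp add: sets closed_stone_set)
  have small: "measure \<mu> (stone_set (S r)) \<le> 6 / real (Suc r)" for r
  proof (rule tendsto_upperbound[OF lim])
    show "eventually (\<lambda>x. (case x of (N, M) \<Rightarrow> real (card (S r \<inter> {M+1..M+N})) / real N)
            \<le> 6 / real (Suc r)) (filter_of q)"
      using T
    proof (rule eventually_mono)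
      fix x :: "nat \<times> nat"
      assume "case x of (N, M) \<Rightarrow> \<forall>p. T p \<le> M + N \<longrightarrow> p \<le> N"
      then show "(case x of (N, M) \<Rightarrow> real (card (S r \<inter> {M+1..M+N})) / real N) \<le> 6 / real (Suc r)"
        unfolding S_def by (cases x) (simp only: prod.case, rule density_periodic_blocks_le, blast)
    qed
  qed simp
  let ?B = "\<Inter>r. stone_set (S r)"
  have B: "?B \<in> sets \<mu>" using meas by auto
  have "measure \<mu> ?B \<le> 6 / real (Suc r)" for r
    using finite_measure_mono[of ?B "stone_set (S r)"] meas small[of r] by fastforce
  moreover have "(\<lambda>r. 6 / real (Suc r)) \<longlonglongrightarrow> 0"
    using tendsto_mult_left[OF LIMSEQ_inverse_real_of_nat, of 6] by (simp add: field_simps)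
  ultimately have "measure \<mu> ?B \<le> 0"
    by (intro tendsto_lowerbound[of "\<lambda>r. 6 / real (Suc r)" 0 sequentially]) auto
  then have "measure \<mu> ?B = 0" by (simp add: order_antisym)
  then have "?B \<in> null_sets \<mu>" using B by (simp add: null_setsI emeasure_eq_measure)
  moreover have "kappa \<subseteq> ?B"
    unfolding S_def
    by (intro INT_greatest kappa_subset_stone_set thickly_syndetic_periodic_blocks
        less_sparse_period)
  ultimately show ?thesis by blast
qed

end
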